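(* Let $k \geq 2$ be an integer and let $t \in \mathbb{Z}_{2^k}$. If $t \neq 0$, write $t = 2^{\alpha}\beta$ where $2 \nmid \beta$ and $0 \le \alpha < k$. Then $$ N_{2}(t, 2^k) = \begin{cases} 2^{k} & \text{if } t = 0, \\ 2^{k+1} & \text{if } t\neq 0,\ 0 \leq \alpha < k - 1 \text{ and } \beta \equiv 1 \pmod 4, \\ 0 & \text{if } t\neq 0,\ 0 \leq \alpha < k - 1 \text{ and } \beta \equiv 3 \pmod 4, \\ 2^{k} & \text{if } t\neq 0 \text{ and } \alpha = k - 1. \end{cases} $$
   Context: $\mathbb{Z}_n$ denotes the ring of integers modulo $n$. For $t \in \mathbb{Z}_n$, $N_2(t,n)$ is the number of ordered pairs $(x_1,x_2) \in \mathbb{Z}_n^2$ with $x_1^2+x_2^2 \equiv t \pmod n$ (zero entries are allowed). In the factorization $t = 2^{\alpha}\beta$ the element $t$ is represented by a nonzero integer in $\{1,\dots,2^k-1\}$. *)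

theory Defs
  imports "HOL-Number_Theory.Number_Theory"
begin

text \<open>
  The ring of integers modulo \<open>n\<close> is the library's \<open>residue_ring n\<close>, whose carrier consists of
  the integer representatives \<open>{0..n - 1}\<close>.
\<close>

definition N2 :: "int \<Rightarrow> int \<Rightarrow> nat" where
  "N2 t n = card {(x1, x2) \<in> carrier (residue_ring n) \<times> carrier (residue_ring n).
                    [x1\<^sup>2 + x2\<^sup>2 = t] (mod n)}"

end

theory Submission
  imports Defs
begin

text \<open>
  Read \<open>x\<^sup>2 + y\<^sup>2\<close> as the norm of the Gaussian integer \<open>x + i y\<close>. Three operations relate the
  numbers of solutions for different right-hand sides and moduli.

  A Gaussian integer of even norm is divisible by \<open>1 + i\<close>, and this division halves the norm. Hence
  \<open>N\<^sub>2(2t, 2n) = 2 N\<^sub>2(t, n)\<close> (lemma \<open>N2_double\<close>), which pulls the factor \<open>2\<^sup>\<alpha>\<close> out of \<open>t\<close>.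

  A residue modulo \<open>n\<close> has two lifts modulo \<open>2n\<close>, so
  \<open>N\<^sub>2(t, 2n) + N\<^sub>2(t + n, 2n) = 4 N\<^sub>2(t, n)\<close> (lemma \<open>N2_lift\<close>).

  Multiplication by a Gaussian integer whose norm is a unit modulo \<open>n\<close> permutes the residues, so it
  injects the solutions for \<open>t\<close> into those for the product of \<open>t\<close> with that norm (lemma
  \<open>N2_mult_norm_le\<close>). For \<open>k \<ge> 2\<close> there is a norm congruent to \<open>1 + 2\<^sup>k\<close> modulo \<open>2\<^sup>k\<^sup>+\<^sup>1\<close>, and
  therefore the two lifts \<open>\<beta>\<close> and \<open>\<beta> + 2\<^sup>k\<close> of an odd \<open>\<beta>\<close> have equally many solutions.

  By the last two facts the count for odd \<open>\<beta>\<close> exactly doubles with each further power of \<open>2\<close> beyond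
  the modulus \<open>4\<close>. Modulo \<open>4\<close> the value \<open>3\<close> is not a sum of two squares, so the residue \<open>1\<close>
  receives all the solutions of \<open>x\<^sup>2 + y\<^sup>2\<close> odd.
\<close>

section \<open>Solution sets in a box\<close>

lemma carrier_residue_ring_int: "carrier (residue_ring n) = {0..<n}"
  by (auto simp: residue_ring_def)

lemma N2_altdef:
  "N2 t n = card {p \<in> {0..<n} \<times> {0..<n}. [(fst p)\<^sup>2 + (snd p)\<^sup>2 = t] (mod n)}"
  unfolding N2_def carrier_residue_ring_int
  by (rule arg_cong[where f = card]) auto

lemma N2_cong: "[s = t] (mod n) \<Longrightarrow> N2 s n = N2 t n"
  unfolding N2_def by (simp add: cong_def)

lemma N2_mod_1 [simp]: "N2 t 1 = 1"
proof -
  have "{p \<in> {0..<1} \<times> {0..<1}. [(fst p)\<^sup>2 + (snd p)\<^sup>2 = t] (mod 1)} = {(0::int, 0::int)}"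
    by auto
  thus ?thesis by (simp add: N2_altdef)
qed

text \<open>
  The condition depends on \<open>x\<close> and \<open>y\<close> only modulo \<open>n\<close>, so each of the \<open>a b\<close> translates of the
  fundamental square contributes the same number of points.
\<close>

lemma card_norm_cong_box:
  fixes a b n t :: int
  assumes "a \<ge> 0" "b \<ge> 0" "n > 0"
  shows "card {p \<in> {0..<a * n} \<times> {0..<b * n}. [(fst p)\<^sup>2 + (snd p)\<^sup>2 = t] (mod n)}
         = nat a * nat b * N2 t n" (is "card ?B = _")
proof -
  let ?S = "{p \<in> {0..<n} \<times> {0..<n}. [(fst p)\<^sup>2 + (snd p)\<^sup>2 = t] (mod n)}"
  let ?A = "?S \<times> ({0..<a} \<times> {0..<b})"
  have red: "[(x mod n)\<^sup>2 + (y mod n)\<^sup>2 = x\<^sup>2 + y\<^sup>2] (mod n)" for x y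
    by (intro cong_add cong_pow) (auto simp: cong_def)
  have box: "0 \<le> x + n * i \<and> x + n * i < c * n"
    if "0 \<le> x" "x < n" "0 \<le> i" "i < c" for x i c :: int
  proof -
    have "n * (i + 1) \<le> n * c" using that assms(3) by (intro mult_left_mono) auto
    moreover have "0 \<le> n * i" using that assms(3) by simp
    ultimately show ?thesis using that by (simp add: algebra_simps)
  qed
  have quot: "0 \<le> x div n \<and> x div n < c" if "0 \<le> x" "x < c * n" for x c
  proof
    show "0 \<le> x div n" using that assms(3) by (simp add: pos_imp_zdiv_nonneg_iff)
    have "n * (x div n) \<le> x" using assms(3) by (simp add: minus_mod_eq_mult_div [symmetric])
    hence "n * (x div n) < n * c" using that by (simp add: mult.commute)
    thus "x div n < c" using assms(3) by (simp only: mult_less_cancel_left_pos)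
  qed
  define f where "f = (\<lambda>((x, y), (i, j)). (x + n * i, y + n * j))"
  define g where "g = (\<lambda>(x, y). ((x mod n, y mod n), (x div n, y div n)))"
  have "bij_betw f ?A ?B"
  proof (rule bij_betw_byWitness[where f' = g])
    show "\<forall>q\<in>?A. g (f q) = q" using assms(3) by (auto simp: f_def g_def)
    show "\<forall>q\<in>?B. f (g q) = q" by (auto simp: f_def g_def)
    show "f ` ?A \<subseteq> ?B"
    proof (rule image_subsetI)
      fix q
      assume "q \<in> ?A"
      then obtain x y i j where q: "q = ((x, y), (i, j))" "[x\<^sup>2 + y\<^sup>2 = t] (mod n)"
        "x \<in> {0..<n}" "y \<in> {0..<n}" "i \<in> {0..<a}" "j \<in> {0..<b}"
        by auto
      have "[(x + n * i)\<^sup>2 + (y + n * j)\<^sup>2 = x\<^sup>2 + y\<^sup>2] (mod n)"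
        by (intro cong_add cong_pow) (auto simp: cong_def)
      with q(2) have "[(x + n * i)\<^sup>2 + (y + n * j)\<^sup>2 = t] (mod n)" by (rule cong_trans [rotated])
      thus "f q \<in> ?B" using q box[of x i a] box[of y j b] by (simp add: f_def)
    qed
    show "g ` ?B \<subseteq> ?A"
      using quot assms(3) by (auto simp: g_def intro: cong_trans[OF red])
  qed
  hence "card ?B = card ?A" by (simp add: bij_betw_same_card)
  thus ?thesis by (simp add: card_cartesian_product N2_altdef)
qed

section \<open>Relations between the counts\<close>

lemma N2_lift:
  fixes n t :: int
  assumes "n > 0"
  shows "N2 t (2 * n) + N2 (t + n) (2 * n) = 4 * N2 t n"
proof -
  let ?S = "\<lambda>s m. {p \<in> {0..<2 * n} \<times> {0..<2 * n}. [(fst p)\<^sup>2 + (snd p)\<^sup>2 = s] (mod m)}"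
  have lifts: "[z = t] (mod n) \<longleftrightarrow> [z = t] (mod (2 * n)) \<or> [z = t + n] (mod (2 * n))" for z
  proof
    assume "[z = t] (mod n)"
    then obtain q where q: "z - t = n * q" by (auto simp: cong_iff_dvd_diff)
    show "[z = t] (mod (2 * n)) \<or> [z = t + n] (mod (2 * n))"
    proof (cases "even q")
      case True
      hence "2 * n dvd z - t" using q by (auto elim!: evenE)
      thus ?thesis by (simp add: cong_iff_dvd_diff)
    next
      case False
      then obtain r where "q = 2 * r + 1" by (auto elim: oddE)
      hence "z - (t + n) = 2 * n * r" using q by (simp add: algebra_simps)
      thus ?thesis by (simp add: cong_iff_dvd_diff)
    qed
  next
    assume "[z = t] (mod (2 * n)) \<or> [z = t + n] (mod (2 * n))"
    hence "[z = t] (mod n) \<or> [z = t + n] (mod n)" by (metis cong_modulus_mult mult.commute)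
    thus "[z = t] (mod n)" by (auto simp: cong_def)
  qed
  have disj: "\<not> ([z = t] (mod (2 * n)) \<and> [z = t + n] (mod (2 * n)))" for z
  proof
    assume "[z = t] (mod (2 * n)) \<and> [z = t + n] (mod (2 * n))"
    hence "[t = t + n] (mod (2 * n))" by (metis cong_sym cong_trans)
    hence "2 * n dvd n" by (simp add: cong_iff_dvd_diff)
    thus False using assms zdvd_imp_le by fastforce
  qed
  have "card (?S t n) = card (?S t (2 * n) \<union> ?S (t + n) (2 * n))"
    using lifts by (intro arg_cong[where f = card]) auto
  also have "\<dots> = N2 t (2 * n) + N2 (t + n) (2 * n)"
    unfolding N2_altdef using disj by (intro card_Un_disjoint) auto
  finally show ?thesis using card_norm_cong_box[of 2 2 n t] assms by simp
qed

text \<open>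
  Multiplication by \<open>1 + i\<close> sends \<open>(u, v)\<close> to \<open>(u - v, u + v)\<close>; the proof uses the variant
  \<open>(u + v, u - v)\<close>, which differs by swapping the coordinates. A pair modulo \<open>2n\<close> determines its
  preimage modulo the lattice spanned by \<open>(n, n)\<close> and \<open>(n, -n)\<close>, for which the box
  \<open>[0, 2n) \<times> [0, n)\<close> is a fundamental domain. That box consists of two copies of the fundamental
  square modulo \<open>n\<close>.
\<close>

lemma N2_double:
  fixes n t :: int
  assumes "n > 0"
  shows "N2 (2 * t) (2 * n) = 2 * N2 t n"
proof -
  let ?A = "{p \<in> {0..<2 * n} \<times> {0..<n}. [(fst p)\<^sup>2 + (snd p)\<^sup>2 = t] (mod n)}"
  let ?B = "{p \<in> {0..<2 * n} \<times> {0..<2 * n}. [(fst p)\<^sup>2 + (snd p)\<^sup>2 = 2 * t] (mod (2 * n))}"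
  define f where "f = (\<lambda>(u, v). ((u + v) mod (2 * n), (u - v) mod (2 * n)))"
  have red: "[(x mod (2 * n))\<^sup>2 + (y mod (2 * n))\<^sup>2 = x\<^sup>2 + y\<^sup>2] (mod (2 * n))" for x y
    by (intro cong_add cong_pow) (auto simp: cong_def)
  have halve: "[(u + v)\<^sup>2 + (u - v)\<^sup>2 = 2 * t] (mod (2 * n)) \<longleftrightarrow> [u\<^sup>2 + v\<^sup>2 = t] (mod n)" for u v
  proof -
    have eq: "(u + v)\<^sup>2 + (u - v)\<^sup>2 - 2 * t = 2 * (u\<^sup>2 + v\<^sup>2 - t)"
      by (simp add: power2_eq_square algebra_simps)
    show ?thesis unfolding cong_iff_dvd_diff eq by (rule dvd_times_left_cancel_iff) simp
  qed
  have "inj_on f ?A"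
  proof (rule inj_onI, clarify)
    fix u v u' v'
    assume u: "u \<in> {0..<2 * n}" "u' \<in> {0..<2 * n}" and v: "v \<in> {0..<n}" "v' \<in> {0..<n}"
      and "f (u, v) = f (u', v')"
    hence "2 * n dvd u + v - (u' + v')" and d: "2 * n dvd u - v - (u' - v')"
      by (auto simp: f_def mod_eq_dvd_iff)
    hence "2 * n dvd (u + v - (u' + v')) - (u - v - (u' - v'))" by (rule dvd_diff)
    also have "(u + v - (u' + v')) - (u - v - (u' - v')) = 2 * (v - v')" by simp
    finally have "[v = v'] (mod n)"
      unfolding cong_iff_dvd_diff by (subst (asm) dvd_times_left_cancel_iff) auto
    hence "v = v'" using v by (simp add: cong_def)
    moreover from this d have "[u = u'] (mod (2 * n))" by (simp add: cong_iff_dvd_diff)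
    hence "u = u'" using u by (simp add: cong_def)
    ultimately show "u = u' \<and> v = v'" by simp
  qed
  moreover have "f ` ?A = ?B"
  proof (rule subset_antisym)
    show "f ` ?A \<subseteq> ?B"
      using assms red halve by (auto simp: f_def intro!: cong_trans[OF red])
    show "?B \<subseteq> f ` ?A"
    proof clarify
      fix x y
      assume x: "x \<in> {0..<2 * n}" and y: "y \<in> {0..<2 * n}"
        and "[(fst (x, y))\<^sup>2 + (snd (x, y))\<^sup>2 = 2 * t] (mod (2 * n))"
      hence xy: "[x\<^sup>2 + y\<^sup>2 = 2 * t] (mod (2 * n))" by simp
      hence "2 * n dvd x\<^sup>2 + y\<^sup>2 - 2 * t" by (simp add: cong_iff_dvd_diff)
      hence "2 dvd x\<^sup>2 + y\<^sup>2 - 2 * t" by (rule dvd_mult_left)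
      hence "even (x - y)" by simp
      then obtain w where w: "x - y = 2 * w" by (rule evenE)
      \<comment> \<open>Reducing \<open>w\<close> modulo \<open>n\<close> changes \<open>2w\<close> by a multiple of \<open>2n\<close> only, so \<open>u\<close> may be adjusted
        to make \<open>u - v\<close> correct and \<open>u + v\<close> follows.\<close>
      define v where "v = w mod n"
      define u where "u = (y + v) mod (2 * n)"
      have v_eq: "v = w - n * (w div n)" by (simp add: v_def minus_mult_div_eq_mod)
      have "(u - v) mod (2 * n) = y mod (2 * n)"
        by (simp add: u_def mod_diff_left_eq)
      hence fy: "(u - v) mod (2 * n) = y" using y by simp
      have "(u + v) mod (2 * n) = (y + v + v) mod (2 * n)"
        by (simp add: u_def mod_add_left_eq)
      also have "y + v + v = x + 2 * n * (- (w div n))"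
        using w v_eq by (simp add: algebra_simps)
      also have "\<dots> mod (2 * n) = x mod (2 * n)" by (rule mod_mult_self2)
      finally have fx: "(u + v) mod (2 * n) = x" using x by simp
      have "[(u + v)\<^sup>2 + (u - v)\<^sup>2 = 2 * t] (mod (2 * n))"
        using red[of "u + v" "u - v"] xy unfolding fx fy by (metis cong_sym cong_trans)
      hence "(u, v) \<in> ?A" using assms halve by (auto simp: u_def v_def)
      thus "(x, y) \<in> f ` ?A" using fx fy by (force simp: f_def)
    qed
  qed
  ultimately have "bij_betw f ?A ?B" unfolding bij_betw_def by (rule conjI)
  hence "card ?A = card ?B" by (rule bij_betw_same_card)
  thus ?thesis using card_norm_cong_box[of 2 1 n t] assms by (simp add: N2_altdef)
qed

corollary N2_power2_mult:
  assumes "(n :: int) > 0"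
  shows "N2 (2 ^ m * t) (2 ^ m * n) = 2 ^ m * N2 t n"
proof (induction m)
  case (Suc m)
  have "N2 (2 * (2 ^ m * t)) (2 * (2 ^ m * n)) = 2 * N2 (2 ^ m * t) (2 ^ m * n)"
    using assms by (intro N2_double) simp
  thus ?case using Suc by (simp add: mult_ac)
qed simp

text \<open>
  Multiplication by \<open>a + i b\<close> multiplies norms by \<open>a\<^sup>2 + b\<^sup>2\<close>. It is injective modulo \<open>n\<close> because
  multiplying once more by \<open>a - i b\<close> gives multiplication by the unit \<open>a\<^sup>2 + b\<^sup>2\<close>.
\<close>

lemma N2_mult_norm_le:
  fixes a b n t :: int
  assumes "n > 0" "coprime (a\<^sup>2 + b\<^sup>2) n"
  shows "N2 t n \<le> N2 ((a\<^sup>2 + b\<^sup>2) * t) n"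
proof -
  define f where "f = (\<lambda>(x, y). ((a * x - b * y) mod n, (b * x + a * y) mod n))"
  let ?S = "\<lambda>s. {p \<in> {0..<n} \<times> {0..<n}. [(fst p)\<^sup>2 + (snd p)\<^sup>2 = s] (mod n)}"
  have cancel: "n dvd d" if "n dvd (a\<^sup>2 + b\<^sup>2) * d" for d
    using that assms(2) by (simp add: coprime_commute coprime_dvd_mult_right_iff)
  have "inj_on f (?S t)"
  proof (rule inj_onI, clarify)
    fix x y x' y'
    assume x: "x \<in> {0..<n}" "x' \<in> {0..<n}" and y: "y \<in> {0..<n}" "y' \<in> {0..<n}"
      and "f (x, y) = f (x', y')"
    hence d: "n dvd a * x - b * y - (a * x' - b * y')" "n dvd b * x + a * y - (b * x' + a * y')"
      by (auto simp: f_def mod_eq_dvd_iff)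
    have "n dvd a * (a * x - b * y - (a * x' - b * y')) + b * (b * x + a * y - (b * x' + a * y'))"
      using d by (intro dvd_add dvd_mult)
    also have "\<dots> = (a\<^sup>2 + b\<^sup>2) * (x - x')" by (simp add: power2_eq_square algebra_simps)
    finally have "[x = x'] (mod n)" unfolding cong_iff_dvd_diff by (rule cancel)
    moreover have
      "n dvd a * (b * x + a * y - (b * x' + a * y')) - b * (a * x - b * y - (a * x' - b * y'))"
      by (intro dvd_diff dvd_mult[OF d(1)] dvd_mult[OF d(2)])
    hence "n dvd (a\<^sup>2 + b\<^sup>2) * (y - y')" by (simp add: power2_eq_square algebra_simps)
    hence "[y = y'] (mod n)" unfolding cong_iff_dvd_diff by (rule cancel)
    ultimately show "x = x' \<and> y = y'" using x y by (simp add: cong_def)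
  qed
  moreover have "f ` ?S t \<subseteq> ?S ((a\<^sup>2 + b\<^sup>2) * t)"
  proof (rule image_subsetI)
    fix p
    assume "p \<in> ?S t"
    then obtain x y where p: "p = (x, y)" "[x\<^sup>2 + y\<^sup>2 = t] (mod n)" by auto
    hence xy: "[(a\<^sup>2 + b\<^sup>2) * (x\<^sup>2 + y\<^sup>2) = (a\<^sup>2 + b\<^sup>2) * t] (mod n)"
      by (simp add: cong_scalar_left)
    have "[((a * x - b * y) mod n)\<^sup>2 + ((b * x + a * y) mod n)\<^sup>2
           = (a * x - b * y)\<^sup>2 + (b * x + a * y)\<^sup>2] (mod n)"
      by (intro cong_add cong_pow) (auto simp: cong_def)
    also have "(a * x - b * y)\<^sup>2 + (b * x + a * y)\<^sup>2 = (a\<^sup>2 + b\<^sup>2) * (x\<^sup>2 + y\<^sup>2)"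
      by (simp add: power2_eq_square algebra_simps)
    also note xy
    finally show "f p \<in> ?S ((a\<^sup>2 + b\<^sup>2) * t)"
      using assms(1) by (simp add: p(1) f_def)
  qed
  ultimately have "card (?S t) \<le> card (?S ((a\<^sup>2 + b\<^sup>2) * t))"
    by (rule card_inj_on_le) simp
  thus ?thesis by (simp add: N2_altdef)
qed

section \<open>Odd residues modulo powers of two\<close>

text \<open>
  For \<open>k \<ge> 3\<close> the square of \<open>1 + 2\<^sup>k\<^sup>-\<^sup>1\<close> works, since the error \<open>2\<^sup>2\<^sup>k\<^sup>-\<^sup>2\<close> then vanishes. For
  \<open>k = 2\<close> the residue \<open>5\<close> is not a square modulo \<open>8\<close>, but it is the norm of \<open>1 + 2i\<close>.
\<close>

lemma norm_cong_one_plus_power2: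
  fixes k :: nat
  assumes "k \<ge> 2"
  obtains a b :: int where "[a\<^sup>2 + b\<^sup>2 = 1 + 2 ^ k] (mod 2 ^ Suc k)"
proof (cases "k = 2")
  case True
  hence "[1\<^sup>2 + 2\<^sup>2 = 1 + 2 ^ k] (mod (2::int) ^ Suc k)" by simp
  thus ?thesis by (rule that)
next
  case False
  define j where "j = k - 3"
  have k: "k = j + 3" using False assms by (simp add: j_def)
  have "(1 + 2 ^ (k - 1))\<^sup>2 + 0\<^sup>2 - (1 + 2 ^ k) = 2 ^ Suc k * (2 ^ j :: int)"
    by (simp add: k power2_eq_square algebra_simps power_add)
  hence "[(1 + 2 ^ (k - 1))\<^sup>2 + 0\<^sup>2 = 1 + 2 ^ k] (mod (2::int) ^ Suc k)"
    unfolding cong_iff_dvd_diff by (metis dvd_triv_left)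
  thus ?thesis by (rule that)
qed

text \<open>
  The injection supplied by such a norm exchanges the two lifts, so following it by itself turns
  the inequality into an equality.
\<close>

lemma N2_odd_lifts_eq:
  fixes k :: nat and \<beta> :: int
  assumes "k \<ge> 2" "odd \<beta>"
  shows "N2 (\<beta> + 2 ^ k) (2 ^ Suc k) = N2 \<beta> (2 ^ Suc k)"
proof -
  obtain a b :: int where ab: "[a\<^sup>2 + b\<^sup>2 = 1 + 2 ^ k] (mod 2 ^ Suc k)"
    using norm_cong_one_plus_power2[OF assms(1)] .
  have "coprime (1 + 2 ^ k) (2 ^ Suc k :: int)" using assms(1) by simp
  hence cop: "coprime (a\<^sup>2 + b\<^sup>2) (2 ^ Suc k)"
    using cong_imp_coprime[OF cong_sym[OF ab]] by blast
  have le: "N2 \<gamma> (2 ^ Suc k) \<le> N2 (\<gamma> + 2 ^ k) (2 ^ Suc k)" if "odd \<gamma>" for \<gamma> :: int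
  proof -
    obtain r where r: "\<gamma> = 2 * r + 1" using \<open>odd \<gamma>\<close> by (rule oddE)
    have "(1 + 2 ^ k) * \<gamma> - (\<gamma> + 2 ^ k) = 2 ^ Suc k * r" by (simp add: r algebra_simps)
    hence "[(1 + 2 ^ k) * \<gamma> = \<gamma> + 2 ^ k] (mod 2 ^ Suc k)"
      unfolding cong_iff_dvd_diff by simp
    hence "[(a\<^sup>2 + b\<^sup>2) * \<gamma> = \<gamma> + 2 ^ k] (mod 2 ^ Suc k)"
      using cong_scalar_right[OF ab, of \<gamma>] by (metis cong_trans)
    thus ?thesis using N2_mult_norm_le[OF _ cop, of \<gamma>] N2_cong by fastforce
  qed
  have "odd (\<beta> + 2 ^ k)" using assms by simp
  from le[OF this] have "N2 (\<beta> + 2 ^ k) (2 ^ Suc k) \<le> N2 (\<beta> + 2 ^ k + 2 ^ k) (2 ^ Suc k)" .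
  also have "\<dots> = N2 \<beta> (2 ^ Suc k)" by (rule N2_cong) (simp add: cong_iff_dvd_diff)
  finally show ?thesis using le[OF assms(2)] by simp
qed

lemma N2_3_mod_4:
  fixes n \<beta> :: int
  assumes "4 dvd n" "[\<beta> = 3] (mod 4)"
  shows "N2 \<beta> n = 0"
proof -
  have "\<not> [x\<^sup>2 + y\<^sup>2 = \<beta>] (mod n)" for x y :: int
  proof
    assume "[x\<^sup>2 + y\<^sup>2 = \<beta>] (mod n)"
    hence "[x\<^sup>2 + y\<^sup>2 = \<beta>] (mod 4)" using assms(1) by (rule cong_dvd_modulus)
    hence "(x\<^sup>2 + y\<^sup>2) mod 4 = 3" using assms(2) by (simp add: cong_def)
    have sq: "z\<^sup>2 mod 4 \<in> {0, 1}" for z :: int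
    proof (cases "even z")
      case True
      then obtain w where "z = 2 * w" by (auto elim: evenE)
      hence "z\<^sup>2 = 4 * w\<^sup>2" by (simp add: power2_eq_square)
      thus ?thesis by simp
    next
      case False
      then obtain w where "z = 2 * w + 1" by (auto elim: oddE)
      hence "z\<^sup>2 = 1 + 4 * (w\<^sup>2 + w)" by (simp add: power2_eq_square algebra_simps)
      thus ?thesis by (simp only: mod_mult_self2) simp
    qed
    show False
      using sq[of x] sq[of y] mod_add_eq[of "x\<^sup>2" 4 "y\<^sup>2"] \<open>(x\<^sup>2 + y\<^sup>2) mod 4 = 3\<close>
      by (auto simp del: mod_add_eq)
  qed
  thus ?thesis by (simp add: N2_def)
qed

lemma N2_odd_mod_2:
  fixes \<beta> :: int
  assumes "odd \<beta>"
  shows "N2 \<beta> 2 = 2"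
proof -
  have "N2 0 2 = 2" using N2_double[of 1 0] by simp
  moreover have "N2 0 2 + N2 1 2 = 4" using N2_lift[of 1 0] by simp
  moreover have "[\<beta> = 1] (mod 2)" using assms by (simp add: cong_def odd_iff_mod_2_eq_one)
  ultimately show ?thesis by (simp add: N2_cong)
qed

lemma N2_1_mod_4:
  fixes k :: nat and \<beta> :: int
  assumes "k \<ge> 2" "[\<beta> = 1] (mod 4)"
  shows "N2 \<beta> (2 ^ k) = 2 ^ (k + 1)"
proof -
  have "odd \<beta>" using assms(2) unfolding cong_def by presburger
  show ?thesis using assms(1)
  proof (induction k rule: nat_induct_at_least)
    case base
    have "[\<beta> + 2 = 3] (mod 4)" using assms(2) unfolding cong_def by presburger
    hence "N2 (\<beta> + 2) 4 = 0" by (simp add: N2_3_mod_4)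
    thus ?case using N2_lift[of 2 \<beta>] N2_odd_mod_2[OF \<open>odd \<beta>\<close>] by simp
  next
    case (Suc k)
    thus ?case using N2_lift[of "2 ^ k" \<beta>] N2_odd_lifts_eq[of k \<beta>] \<open>odd \<beta>\<close> by simp
  qed
qed

section \<open>The count for an arbitrary residue\<close>

theorem theorem1p3:
  fixes k \<alpha> :: nat and t \<beta> :: int
  assumes "k \<ge> 2"
    and "t \<in> carrier (residue_ring (2 ^ k))"
    and "t \<noteq> 0 \<Longrightarrow> t = 2 ^ \<alpha> * \<beta> \<and> \<not> 2 dvd \<beta> \<and> \<alpha> < k"
  shows "(t = 0 \<longrightarrow> N2 t (2 ^ k) = 2 ^ k) \<and>
         (t \<noteq> 0 \<and> \<alpha> < k - 1 \<and> [\<beta> = 1] (mod 4) \<longrightarrow> N2 t (2 ^ k) = 2 ^ (k + 1)) \<and>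
         (t \<noteq> 0 \<and> \<alpha> < k - 1 \<and> [\<beta> = 3] (mod 4) \<longrightarrow> N2 t (2 ^ k) = 0) \<and>
         (t \<noteq> 0 \<and> \<alpha> = k - 1 \<longrightarrow> N2 t (2 ^ k) = 2 ^ k)"
proof (cases "t = 0")
  case True
  thus ?thesis using N2_power2_mult[of 1 k 0] by simp
next
  case False
  with assms(3) have t: "t = 2 ^ \<alpha> * \<beta>" "odd \<beta>" "\<alpha> < k" by auto
  define j where "j = k - \<alpha>"
  have k: "k = \<alpha> + j" using t by (simp add: j_def)
  have N2_t: "N2 t (2 ^ k) = 2 ^ \<alpha> * N2 \<beta> (2 ^ j)"
    using N2_power2_mult[of "2 ^ j" \<alpha> \<beta>] by (simp add: t k power_add)
  have "N2 t (2 ^ k) = 2 ^ (k + 1)" if "\<alpha> < k - 1" "[\<beta> = 1] (mod 4)"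
    
  proof -
    have "j \<ge> 2" using that by (simp add: k)
    thus ?thesis using N2_1_mod_4[of j \<beta>] that by (simp add: N2_t) (simp add: k power_add)
  qed
  moreover have "N2 t (2 ^ k) = 0" if "\<alpha> < k - 1" "[\<beta> = 3] (mod 4)"
  proof -
    have "(2::int) ^ 2 dvd 2 ^ j" using that by (intro le_imp_power_dvd) (simp add: k)
    thus ?thesis using that by (simp add: N2_t N2_3_mod_4)
  qed
  moreover have "N2 t (2 ^ k) = 2 ^ k" if "\<alpha> = k - 1"
  proof -
    have "j = 1" using that t by (simp add: k)
    thus ?thesis using N2_odd_mod_2[OF t(2)] by (simp add: N2_t) (simp add: k)
  qed
  ultimately show ?thesis using False by blast
qed

end
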